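(* Let $A_{\mathrm M}$ be a set and let $f$, $f^{(\sigma)}$ ($\sigma\in A_{\mathrm M}$) be self-maps of $\mathbb{R}^n$ with $f(v)=\min_{\sigma\in A_{\mathrm M}}f^{(\sigma)}(v)$ for all $v\in\mathbb{R}^n$. Let $\varphi\in\mathbb{R}^n$ have strictly positive coordinates, and put $\tilde f:=\mathcal S_\varphi(f)$ and $\tilde f^{(\sigma)}:=\mathcal S_\varphi(f^{(\sigma)})$. Then $A_{\mathrm M}$, $\tilde f$, $(\tilde f^{(\sigma)})_{\sigma}$ constitute a valid input of the general policy iteration algorithm. Moreover, $\sigma^s$ and $\tilde v^s=\varphi^{-1}v^s$ ($s\ge 0$) constitute an admissible sequence of policies and fixed points for this input if and only if $\sigma^s$ and $v^s$ constitute an admissible sequence of policies and fixed points for the original input $A_{\mathrm M}$, $f$, $(f^{(\sigma)})_\sigma$.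
   Context: $\mathbb{R}^n$ has the coordinatewise order. For vectors, $\varphi^{-1}=(\varphi_i^{-1})_i$ and $\varphi v=(\varphi_iv_i)_i$. For a self-map $g$ of $\mathbb{R}^n$, $\mathcal S_\varphi(g)$ is the map $v\mapsto\varphi^{-1}g(\varphi v)$. The minimum $\min_\sigma f^{(\sigma)}(v)$ is taken in the coordinatewise order and is attained: $f(v)\le f^{(\sigma)}(v)$ for all $\sigma$, with equality for some $\sigma$ depending on $v$. General policy iteration algorithm. A valid input is a set $A_{\mathrm M}$ and self-maps $f,f^{(\sigma)}$ ($\sigma\in A_{\mathrm M}$) of $\mathbb{R}^n$ with $f(v)=\min_\sigma f^{(\sigma)}(v)$ (attained) for all $v$. (1) Set $s=0$ and choose an arbitrary $\sigma^0\in A_{\mathrm M}$. (2) Compute the fixed point $v^s$ of $f^{(\sigma^s)}$. (3) Choose $\sigma^{s+1}\in A_{\mathrm M}$ with $f(v^s)=f^{(\sigma^{s+1})}(v^s)$, taking $\sigma^{s+1}=\sigma^s$ whenever possible. (4) If $\sigma^{s+1}=\sigma^s$, stop and return $v^s$ and $\sigma^s$; otherwise increment $s$ and go to (2). A sequence of policies and fixed points is admissible for a given input if there is a valid run of the algorithm on this input producing this sequence. *)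

theory Defs
  imports "HOL-Analysis.Analysis" "HOL-Library.Extended_Nat"
begin

text \<open>On \<open>real ^ 'n\<close> the library order \<open>\<le>\<close> and the product \<open>*\<close> are both coordinatewise,
  so \<open>\<phi> * v\<close> is the vector with coordinates \<open>\<phi>\<^sub>i v\<^sub>i\<close>.\<close>

definition vec_inverse :: "real ^ 'n \<Rightarrow> real ^ 'n" where
  "vec_inverse \<phi> = (\<chi> i. inverse (\<phi> $ i))"

definition scaled_map :: "real ^ 'n \<Rightarrow> (real ^ 'n \<Rightarrow> real ^ 'n) \<Rightarrow> real ^ 'n \<Rightarrow> real ^ 'n" where
  "scaled_map \<phi> g = (\<lambda>v. vec_inverse \<phi> * g (\<phi> * v))"

text \<open>The family \<open>F\<close> is total on the policy type, but only its members indexed by \<open>A\<close> matter.\<close>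

definition valid_input ::
  "'p set \<Rightarrow> (real ^ 'n \<Rightarrow> real ^ 'n) \<Rightarrow> ('p \<Rightarrow> real ^ 'n \<Rightarrow> real ^ 'n) \<Rightarrow> bool" where
  "valid_input A f F \<longleftrightarrow>
     (\<forall>v. (\<forall>\<sigma>\<in>A. f v \<le> F \<sigma> v) \<and> (\<exists>\<sigma>\<in>A. f v = F \<sigma> v))"

definition is_the_fixed_point :: "('a \<Rightarrow> 'a) \<Rightarrow> 'a \<Rightarrow> bool" where
  "is_the_fixed_point g v \<longleftrightarrow> g v = v \<and> (\<forall>w. g w = w \<longrightarrow> w = v)"

text \<open>\<open>\<tau>\<close> is a legal successor of the policy \<open>\<sigma>\<close> at the point \<open>v\<close>; the last conjunct forces
  the current policy to be kept whenever it is itself optimal at \<open>v\<close>.\<close>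

definition policy_choice ::
  "'p set \<Rightarrow> (real ^ 'n \<Rightarrow> real ^ 'n) \<Rightarrow> ('p \<Rightarrow> real ^ 'n \<Rightarrow> real ^ 'n)
     \<Rightarrow> real ^ 'n \<Rightarrow> 'p \<Rightarrow> 'p \<Rightarrow> bool" where
  "policy_choice A f F v \<sigma> \<tau> \<longleftrightarrow>
     \<tau> \<in> A \<and> f v = F \<tau> v \<and> (\<sigma> \<in> A \<and> f v = F \<sigma> v \<longrightarrow> \<tau> = \<sigma>)"

text \<open>A run either stops after finitely many iterations or goes on forever. \<open>N\<close> is the index of
  the last iteration (\<open>\<infinity>\<close> for a run that does not stop), and only the values of \<open>\<sigma>\<close> and \<open>v\<close>
  at indices \<open>s \<le> N\<close> are constrained: the sequence produced is \<open>(\<sigma> s, v s)\<close> for \<open>s \<le> N\<close>.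
  At a finite \<open>N\<close> the policy chosen is \<open>\<sigma> N\<close> again.\<close>

definition admissible ::
  "'p set \<Rightarrow> (real ^ 'n \<Rightarrow> real ^ 'n) \<Rightarrow> ('p \<Rightarrow> real ^ 'n \<Rightarrow> real ^ 'n)
     \<Rightarrow> enat \<Rightarrow> (nat \<Rightarrow> 'p) \<Rightarrow> (nat \<Rightarrow> real ^ 'n) \<Rightarrow> bool" where
  "admissible A f F N \<sigma> v \<longleftrightarrow>
     \<sigma> 0 \<in> A \<and>
     (\<forall>s. enat s \<le> N \<longrightarrow> is_the_fixed_point (F (\<sigma> s)) (v s)) \<and>
     (\<forall>s. enat s < N \<longrightarrow>
        policy_choice A f F (v s) (\<sigma> s) (\<sigma> (Suc s)) \<and> \<sigma> (Suc s) \<noteq> \<sigma> s) \<and>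
     (\<forall>s. enat s = N \<longrightarrow> policy_choice A f F (v s) (\<sigma> s) (\<sigma> s))"

end

theory Submission
  imports Defs
begin

text \<open>For positive \<open>\<phi>\<close>, multiplication by \<open>vec_inverse \<phi>\<close>
  is an order automorphism of the space with inverse \<open>v \<mapsto> \<phi> * v\<close>, and it
  conjugates \<open>g\<close> to \<open>scaled_map \<phi> g\<close>. The algorithm sees its maps
  only through minima, fixed points and equalities of values, all of which such a conjugation
  preserves. The key relation is \<open>scaled_map_vec_inverse_mult\<close>; policies and stopping
  index stay the same.\<close>

lemma vec_inverse_mult_cancel:
  assumes "\<forall>i. \<phi> $ i \<noteq> 0"
  shows "\<phi> * (vec_inverse \<phi> * v) = v" "vec_inverse \<phi> * (\<phi> * v) = v"
  using assms by (simp_all add: vec_inverse_def vec_eq_iff)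

lemma vec_inverse_mult_eq_iff:
  assumes "\<forall>i. \<phi> $ i \<noteq> 0"
  shows "vec_inverse \<phi> * v = vec_inverse \<phi> * w \<longleftrightarrow> v = w"
  by (metis vec_inverse_mult_cancel(1)[OF assms])

text \<open>The sign of \<open>\<phi>\<close> matters here: a negative coordinate would reverse the
  order.\<close>

lemma vec_inverse_mult_le_iff:
  assumes "\<forall>i. \<phi> $ i > 0"
  shows "vec_inverse \<phi> * v \<le> vec_inverse \<phi> * w \<longleftrightarrow> v \<le> w"
  using assms by (simp add: vec_inverse_def less_eq_vec_def)

text \<open>The conjugacy relation: the inner factor \<open>\<phi>\<close> cancels the rescaling of
  the argument.\<close>

lemma scaled_map_vec_inverse_mult:
  assumes "\<forall>i. \<phi> $ i \<noteq> 0"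
  shows "scaled_map \<phi> g (vec_inverse \<phi> * v) = vec_inverse \<phi> * g v"
  by (simp add: scaled_map_def vec_inverse_mult_cancel[OF assms])

text \<open>A policy minimising at \<open>\<phi> * v\<close> for the original family minimises at
  \<open>v\<close> for the scaled one.\<close>

lemma valid_input_scaled_map:
  assumes "valid_input A f F" and "\<forall>i. \<phi> $ i > 0"
  shows "valid_input A (scaled_map \<phi> f) (\<lambda>\<sigma>. scaled_map \<phi> (F \<sigma>))"
  using assms(1) unfolding valid_input_def scaled_map_def vec_inverse_mult_le_iff[OF assms(2)]
  by metis

lemma is_the_fixed_point_scaled_map:
  assumes "\<forall>i. \<phi> $ i \<noteq> 0"
  shows "is_the_fixed_point (scaled_map \<phi> g) (vec_inverse \<phi> * v) \<longleftrightarrow> is_the_fixed_point g v"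
proof -
  have fixed: "scaled_map \<phi> g (vec_inverse \<phi> * w) = vec_inverse \<phi> * w \<longleftrightarrow> g w = w" for w
    by (simp add: scaled_map_vec_inverse_mult[OF assms] vec_inverse_mult_eq_iff[OF assms])
  \<comment> \<open>Uniqueness ranges over all points, so an arbitrary \<open>w\<close> is first
    written as \<open>vec_inverse \<phi> * (\<phi> * w)\<close> to bring it into the form that
    \<open>fixed\<close> covers.\<close>
  show ?thesis
    unfolding is_the_fixed_point_def
    by (metis fixed vec_inverse_mult_cancel(2)[OF assms] vec_inverse_mult_eq_iff[OF assms])
qed

lemma policy_choice_scaled_map:
  assumes "\<forall>i. \<phi> $ i \<noteq> 0"
  shows "policy_choice A (scaled_map \<phi> f) (\<lambda>\<sigma>. scaled_map \<phi> (F \<sigma>)) (vec_inverse \<phi> * v) \<sigma> \<tau>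
    \<longleftrightarrow> policy_choice A f F v \<sigma> \<tau>"
  by (simp add: policy_choice_def scaled_map_vec_inverse_mult[OF assms]
      vec_inverse_mult_eq_iff[OF assms])

text \<open>The conditions on a run match one by one, since those on policies alone do not involve
  \<open>\<phi>\<close>.\<close>

lemma admissible_scaled_map:
  assumes "\<forall>i. \<phi> $ i \<noteq> 0"
  shows "admissible A (scaled_map \<phi> f) (\<lambda>\<sigma>. scaled_map \<phi> (F \<sigma>)) N \<sigma> (\<lambda>s. vec_inverse \<phi> * v s)
    \<longleftrightarrow> admissible A f F N \<sigma> v"
  by (simp add: admissible_def is_the_fixed_point_scaled_map[OF assms]
      policy_choice_scaled_map[OF assms])

theorem proposition6:
  fixes A :: "'p set"
    and f :: "real ^ 'n \<Rightarrow> real ^ 'n"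
    and F :: "'p \<Rightarrow> real ^ 'n \<Rightarrow> real ^ 'n"
    and \<phi> :: "real ^ 'n"
  assumes "valid_input A f F"
    and "\<forall>i. \<phi> $ i > 0"
  shows "valid_input A (scaled_map \<phi> f) (\<lambda>\<sigma>. scaled_map \<phi> (F \<sigma>)) \<and>
    (\<forall>(N :: enat) (\<sigma> :: nat \<Rightarrow> 'p) (v :: nat \<Rightarrow> real ^ 'n).
       admissible A (scaled_map \<phi> f) (\<lambda>\<sigma>. scaled_map \<phi> (F \<sigma>)) N \<sigma> (\<lambda>s. vec_inverse \<phi> * v s)
       \<longleftrightarrow> admissible A f F N \<sigma> v)"
proof -
  have "\<forall>i. \<phi> $ i \<noteq> 0"
    using assms(2) by (metis less_irrefl)
  then show ?thesis
    using valid_input_scaled_map[OF assms] admissible_scaled_map by blast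
qed

end
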